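(* Define $\{a_n\}$, $\{b_n\}$ by $f_1f_5=\sum_{n\ge0}a_nq^n$ and $f_1^6=\sum_{n\ge0}b_nq^n$. Then \[ \{n\ge0: b_n\equiv 0\pmod{25}\}\subsetneqq\{n\ge0: a_n\equiv 0\pmod{25}\}. \]
   Context: $f_j:=\prod_{n=1}^{\infty}(1-q^{jn})$. *)

theory Defs
  imports
    "HOL-Analysis.Infinite_Products"
    "HOL-Computational_Algebra.Formal_Power_Series"
    "HOL-Number_Theory.Cong"
begin

text \<open>
  The formal power series \<open>f\<^sub>j = \<Prod>\<^bsub>n\<ge>1\<^esub> (1 - q\<^bsup>jn\<^esup>)\<close> over the integers, \<open>q\<close> being the
  indeterminate \<^const>\<open>fps_X\<close>. The product of the library starts at \<open>n = 0\<close>, hence the shift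
  by \<^const>\<open>Suc\<close>; it is taken with respect to the topology of formal power series, in which it
  converges for every \<open>j > 0\<close>, as shown below. For \<open>j = 0\<close> the value is meaningless.
\<close>

definition euler_fps :: "nat \<Rightarrow> int fps" where
  "euler_fps j = (\<Prod>n. 1 - fps_X ^ (j * Suc n))"

lemma has_prod_euler_fps:
  assumes "j > 0"
  shows "(\<lambda>n. 1 - fps_X ^ (j * Suc n)) has_prod euler_fps j"
proof -
  let ?f = "\<lambda>n. 1 - fps_X ^ (j * Suc n) :: int fps"
  have nth0: "fps_nth (?f n) 0 = 1" for n
    using assms by simp
  have nz: "?f n \<noteq> 0" for n
    using nth0[of n] by (metis fps_zero_nth zero_neq_one)
  have sub: "subdegree (?f k - 1) > n" if "k > n" for n k
  proof -
    have "n < Suc k" using that by simp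
    also have "\<dots> \<le> j * Suc k" using assms by (cases j) auto
    finally show ?thesis
      by (simp add: subdegree_uminus del: mult_Suc_right)
  qed
  obtain P where P: "(\<lambda>N. \<Prod>k\<le>N. ?f k) \<longlonglongrightarrow> P"
    using tendsto_prod_fps[of ?f "\<lambda>n. n"] nz sub by blast
  have "eventually (\<lambda>N. fps_nth (\<Prod>k\<le>N. ?f k) 0 = fps_nth P 0) sequentially"
    using P unfolding tendsto_fps_iff by blast
  moreover have "fps_nth (\<Prod>k\<le>N. ?f k) 0 = 1" for N
    by (induction N) (use nth0 in \<open>auto simp del: mult_Suc_right\<close>)
  ultimately have "fps_nth P 0 = 1"
    by simp
  then have "P \<noteq> 0"
    by (metis fps_zero_nth zero_neq_one)
  with P have "?f has_prod P"
    by (simp add: has_prod_def raw_has_prod_def)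
  then show ?thesis
    unfolding euler_fps_def using has_prod_unique by blast
qed

end

theory Submission
  imports Defs "HOL-Computational_Algebra.Polynomial"
begin

text \<open>
  The triple product gives \<open>f\<^sub>1 f\<^sub>5 = f(-q, -q\<^sup>4) f(-q\<^sup>2, -q\<^sup>3)\<close> in Ramanujan's notation, and Jacobi's
  identity gives \<open>f\<^sub>1\<^sup>3\<close> as a weighted theta series. Rewriting the products of theta series in terms of
  Gaussian integers \<open>\<alpha> = u + i v\<close> of norm \<open>m = 4 n + 1\<close>, one finds that \<open>4 b\<^sub>n\<close> is the sum of
  \<open>(-1)\<^sup>v Re \<alpha>\<^sup>2\<close> and \<open>4 a\<^sub>n\<close> the sum of \<open>(-1)\<^sup>v \<chi>(\<alpha>)\<close>, where \<open>\<chi>\<close> is the quadratic character modulo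
  the prime \<open>2 + i\<close>. If 5 does not divide \<open>m\<close>, then either \<open>\<chi>(m) = -1\<close> and complex conjugation
  shows \<open>a\<^sub>n = 0\<close>, or already the individual terms satisfy
  \<open>2 Re \<alpha>\<^sup>2 \<equiv> (1 + m\<^sup>2) \<chi>(\<alpha>) (mod 25)\<close>. The powers of 5 in \<open>m\<close> are removed with the Hecke operator at 5,
  which acts on both sums, modulo 25, by a unit. The inclusion is strict since \<open>b\<^sub>3 = 10\<close> and \<open>a\<^sub>3 = 0\<close>.
\<close>

section \<open>Two weighted counts of Gaussian integers\<close>

text \<open>The Legendre symbol modulo 5. Since i is -2 modulo 2 + i,
  \<open>chi5 (u - 2 * v)\<close> is the quadratic character of u + i v modulo 2 + i.\<close>

definition chi5 :: "int \<Rightarrow> int" where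
  "chi5 w = (if w mod 5 = 0 then 0 else if w mod 5 \<in> {1, 4} then 1 else - 1)"

definition norm_reps :: "nat \<Rightarrow> (int \<times> int) set" where
  "norm_reps m = {(u, v). u\<^sup>2 + v\<^sup>2 = int m}"

definition parity_sign :: "int \<Rightarrow> int" where
  "parity_sign v = (if even v then 1 else - 1)"

text \<open>
  The summands of the next two sums do not change when \<open>u + i v\<close> is multiplied by \<open>i\<close>, provided that
  \<open>m\<close> is odd; hence the factor 4 in their relation to \<open>a\<^sub>n\<close> and \<open>b\<^sub>n\<close>. As modular forms they have
  weight 1 and 3.
\<close>
definition theta1 :: "nat \<Rightarrow> int" where
  "theta1 m = (\<Sum>(u, v)\<in>norm_reps m. parity_sign v * chi5 (u - 2 * v))"

definition theta3 :: "nat \<Rightarrow> int" where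
  "theta3 m = (\<Sum>(u, v)\<in>norm_reps m. parity_sign v * (u\<^sup>2 - v\<^sup>2))"

section \<open>The quadratic character modulo 5\<close>

lemma mod5_cases:
  fixes w :: int
  obtains "w mod 5 = 0" | "w mod 5 = 1" | "w mod 5 = 2" | "w mod 5 = 3" | "w mod 5 = 4"
proof -
  have "w mod 5 = 0 \<or> w mod 5 = 1 \<or> w mod 5 = 2 \<or> w mod 5 = 3 \<or> w mod 5 = 4"
    by presburger
  then show ?thesis
    by (elim disjE) (rule that, assumption)+
qed

lemma chi5_mod: "chi5 (w mod 5) = chi5 w"
  by (simp add: chi5_def)

lemma chi5_cong: "[v = w] (mod 5) \<Longrightarrow> chi5 v = chi5 w"
  by (simp add: chi5_def cong_def)

lemma chi5_uminus: "chi5 (- w) = chi5 w"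
  unfolding chi5_def insert_iff empty_iff by presburger

lemma chi5_double: "chi5 (2 * w) = - chi5 w"
  unfolding chi5_def insert_iff empty_iff by presburger

lemma chi5_mult: "chi5 (v * w) = chi5 v * chi5 w"
proof -
  have "chi5 (v * w) = chi5 ((v mod 5) * (w mod 5))"
    by (rule chi5_cong) (simp add: cong_def mod_mult_eq)
  also have "\<dots> = chi5 (v mod 5) * chi5 (w mod 5)"
    by (cases v rule: mod5_cases; cases w rule: mod5_cases; simp add: chi5_def)
  finally show ?thesis
    by (simp add: chi5_mod)
qed

lemma chi5_eq_0_iff: "chi5 w = 0 \<longleftrightarrow> 5 dvd w"
  by (auto simp: chi5_def)

text \<open>Euler's criterion for the prime 5, where (5 - 1) / 2 = 2.\<close>

lemma square_cong_chi5: "5 dvd w\<^sup>2 - chi5 w"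
proof -
  have "[w\<^sup>2 = (w mod 5)\<^sup>2] (mod 5)"
    by (simp add: cong_def power_mod)
  moreover have "[(w mod 5)\<^sup>2 = chi5 w] (mod 5)"
    by (cases w rule: mod5_cases) (simp_all add: chi5_def cong_def)
  ultimately show ?thesis
    using cong_iff_dvd_diff cong_trans by blast
qed

lemma finite_norm_reps: "finite (norm_reps m)"
proof (rule finite_subset)
  have *: "\<bar>u\<bar> \<le> int m" if "u\<^sup>2 + v\<^sup>2 = int m" for u v :: int
  proof -
    have "\<bar>u\<bar> \<le> u\<^sup>2"
      by (metis abs_ge_zero abs_le_square_iff abs_of_nonneg int_one_le_iff_zero_less
          mult_cancel_left2 mult_left_mono order_le_less power2_abs power2_eq_square zero_le_power2)
    also have "\<dots> \<le> int m"
      using that by (metis le_add_same_cancel1 zero_le_power2)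
    finally show ?thesis .
  qed
  have "\<bar>u\<bar> \<le> int m \<and> \<bar>v\<bar> \<le> int m" if "(u, v) \<in> norm_reps m" for u v
    using that *[of u v] *[of v u] by (simp add: norm_reps_def add.commute)
  then show "norm_reps m \<subseteq> {- int m..int m} \<times> {- int m..int m}"
    by fastforce
qed simp

text \<open>
  \<open>u - 2 * v\<close> and \<open>u + 2 * v\<close> are the residues of \<open>u + i v\<close> at the two primes above 5.
\<close>
lemma chi5_norm:
  fixes u v :: int
  assumes "u\<^sup>2 + v\<^sup>2 = m"
  shows "chi5 (u - 2 * v) * chi5 (u + 2 * v) = chi5 m"
proof -
  have "m - (u - 2 * v) * (u + 2 * v) = 5 * v\<^sup>2"
    using assms by (simp add: algebra_simps power2_eq_square)
  then have "[m = (u - 2 * v) * (u + 2 * v)] (mod 5)"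
    by (simp add: cong_iff_dvd_diff)
  then show ?thesis
    using chi5_cong chi5_mult by metis
qed

text \<open>
  Since \<open>7\<^sup>2 = - 1\<close> modulo 25, the squares \<open>s\<close> and \<open>t\<close> below are the residues modulo 25 of the square of
  \<open>u + i v\<close> and of its conjugate; both are \<open>c\<close> modulo 5, so that \<open>(s - c) (t - c)\<close> vanishes modulo 25.
\<close>
lemma square_diff_cong_chi5:
  fixes u v m :: int
  assumes "u\<^sup>2 + v\<^sup>2 = m" and "chi5 m = 1"
  shows "25 dvd 2 * (u\<^sup>2 - v\<^sup>2) - (1 + m\<^sup>2) * chi5 (u - 2 * v)"
proof -
  define c where "c = chi5 (u - 2 * v)"
  define s where "s = (u - 7 * v)\<^sup>2"
  define t where "t = (u + 7 * v)\<^sup>2"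
  have "chi5 (u - 7 * v) = c"
    unfolding c_def by (rule chi5_cong) (simp add: cong_iff_dvd_diff)
  moreover have "chi5 (u + 7 * v) = chi5 (u + 2 * v)"
    by (rule chi5_cong) (simp add: cong_iff_dvd_diff)
  moreover have c: "c * chi5 (u + 2 * v) = 1"
    using chi5_norm[OF assms(1)] assms(2) by (simp add: c_def)
  then have "chi5 (u + 2 * v) = c" "c * c = 1"
    by (auto simp: zmult_eq_1_iff)
  ultimately have "5 dvd s - c" "5 dvd t - c"
    using square_cong_chi5 unfolding s_def t_def by metis+
  then have "25 dvd (s - c) * (t - c)"
    using mult_dvd_mono by fastforce
  then have "25 dvd s * t - c * (s + t) + 1"
    using \<open>c * c = 1\<close> by (simp add: algebra_simps)
  \<comment> \<open>Here \<open>s * t\<close> is the square of u^2 - 49 v^2, and 49 is -1 modulo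
    25.\<close>
  moreover have "s * t - m\<^sup>2 = 25 * (4 * v ^ 2 * (23 * v\<^sup>2 - u\<^sup>2) + 4 * v ^ 4)"
    unfolding s_def t_def assms(1)[symmetric] by (simp add: algebra_simps power2_eq_square power4_eq_xxxx)
  moreover have "s + t - 2 * (u\<^sup>2 - v\<^sup>2) = 25 * (4 * v\<^sup>2)"
    unfolding s_def t_def by (simp add: algebra_simps power2_eq_square)
  ultimately have "25 dvd (s * t - c * (s + t) + 1) - (s * t - m\<^sup>2) + c * (s + t - 2 * (u\<^sup>2 - v\<^sup>2))"
    by (metis dvd_add dvd_diff dvd_mult dvd_triv_left)
  then have *: "25 dvd m\<^sup>2 - c * (2 * (u\<^sup>2 - v\<^sup>2)) + 1"
    by (simp add: algebra_simps)
  have "2 * (u\<^sup>2 - v\<^sup>2) - (1 + m\<^sup>2) * c = - c * (m\<^sup>2 - c * (2 * (u\<^sup>2 - v\<^sup>2)) + 1)"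
    using \<open>c * c = 1\<close> by algebra
  then show ?thesis
    using * unfolding c_def[symmetric] by (metis dvd_mult)
qed

text \<open>Conjugation exchanges u - 2 v and u + 2 v, whose characters are opposite by
  \<open>chi5_norm\<close>, so the sum equals its own negative.\<close>

lemma theta1_eq_0:
  assumes "chi5 (int m) = - 1"
  shows "theta1 m = 0"
proof -
  have "theta1 m = (\<Sum>(u, v)\<in>norm_reps m. parity_sign v * chi5 (u + 2 * v))"
    unfolding theta1_def
    by (rule sum.reindex_bij_witness[of _ "\<lambda>(u, v). (u, - v)" "\<lambda>(u, v). (u, - v)"])
       (auto simp: norm_reps_def parity_sign_def)
  also have "\<dots> = (\<Sum>(u, v)\<in>norm_reps m. - (parity_sign v * chi5 (u - 2 * v)))"
  proof (rule sum.cong, goal_cases)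
    case (2 z)
    obtain u v where z: "z = (u, v)" by force
    have "chi5 (u - 2 * v) * chi5 (u + 2 * v) = - 1"
      using 2 assms chi5_norm[of u v "int m"] by (simp add: z norm_reps_def)
    then have "chi5 (u + 2 * v) = - chi5 (u - 2 * v)"
      by (auto simp: chi5_def split: if_splits)
    then show ?case
      by (simp add: z)
  qed simp
  also have "\<dots> = - theta1 m"
    by (simp add: theta1_def sum_negf case_prod_unfold)
  finally show ?thesis
    by simp
qed

text \<open>If m is a square modulo 5, summing \<open>square_diff_cong_chi5\<close> with signs
  relates the two counts modulo 25. The factor 1 + m^2 can be cancelled, being 2 modulo 5.\<close>

lemma dvd_theta1_coprime:
  assumes "\<not> 5 dvd m" and "25 dvd theta3 m"
  shows "25 dvd theta1 m"
proof (cases "chi5 (int m) = - 1")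
  case True
  then show ?thesis
    by (simp add: theta1_eq_0)
next
  case False
  then have m: "chi5 (int m) = 1"
    using assms(1) by (auto simp: chi5_def split: if_splits; presburger)
  have *: "25 dvd parity_sign v * (2 * (u\<^sup>2 - v\<^sup>2) - (1 + (int m)\<^sup>2) * chi5 (u - 2 * v))"
    if "(u, v) \<in> norm_reps m" for u v
    using that m square_diff_cong_chi5[of u v "int m"] by (auto simp: norm_reps_def intro!: dvd_mult)
  have "25 dvd (\<Sum>(u, v)\<in>norm_reps m. parity_sign v *
          (2 * (u\<^sup>2 - v\<^sup>2) - (1 + (int m)\<^sup>2) * chi5 (u - 2 * v)))"
    using * by (auto intro!: dvd_sum)
  also have "\<dots> = 2 * theta3 m - (1 + (int m)\<^sup>2) * theta1 m"
    unfolding theta1_def theta3_def sum_distrib_left sum_subtractf[symmetric]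
    by (rule sum.cong) (auto simp: algebra_simps)
  finally have **: "25 dvd (1 + (int m)\<^sup>2) * theta1 m"
    using dvd_diff[OF dvd_mult[OF assms(2), of 2]] by fastforce
  have "\<not> 5 dvd 1 + (int m)\<^sup>2"
  proof -
    have "int m mod 5 = 1 \<or> int m mod 5 = 4"
      using m by (auto simp: chi5_def split: if_splits)
    then have "(1 + (int m mod 5)\<^sup>2) mod 5 = 2"
      by auto
    then have "(1 + (int m)\<^sup>2) mod 5 = 2"
      by (metis mod_add_right_eq power_mod)
    then show ?thesis
      by presburger
  qed
  then have "coprime 5 (1 + (int m)\<^sup>2)"
    by (intro prime_imp_coprime) auto
  then have "coprime (5 ^ 2) (1 + (int m)\<^sup>2)"
    by (rule coprime_power_left_iff[THEN iffD2, OF disjI1])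
  then have "coprime 25 (1 + (int m)\<^sup>2)"
    by simp
  with ** show ?thesis
    by (simp only: coprime_dvd_mult_right_iff)
qed

text \<open>
  For \<open>e = \<plusminus> 1\<close> the reindexing is multiplication by the Gaussian integer \<open>1 + 2 e i\<close> of norm 5.
\<close>
lemma sum_norm_reps_mult_5:
  fixes e :: int and g :: "int \<Rightarrow> int \<Rightarrow> int"
  assumes "e * e = 1"
  shows "(\<Sum>(x, y)\<in>{(x, y)\<in>norm_reps (5 * m). 5 dvd x + 2 * e * y}. g x y) =
         (\<Sum>(u, v)\<in>norm_reps m. g (u - 2 * e * v) (2 * e * u + v))"
proof (rule sum.reindex_bij_witness[symmetric, of _ "\<lambda>(x, y). ((x + 2 * e * y) div 5, (y - 2 * e * x) div 5)"
      "\<lambda>(u, v). (u - 2 * e * v, 2 * e * u + v)"], goal_cases)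
  case (1 z)
  obtain u v where z: "z = (u, v)" by force
  have *: "(u - 2 * e * v) + 2 * e * (2 * e * u + v) = 5 * u" "(2 * e * u + v) - 2 * e * (u - 2 * e * v) = 5 * v"
    using assms by algebra+
  show ?case
    unfolding z prod.case * by simp
next
  case (2 z)
  obtain u v where z: "z = (u, v)" by force
  have "(u - 2 * e * v) + 2 * e * (2 * e * u + v) = 5 * u"
    "(u - 2 * e * v)\<^sup>2 + (2 * e * u + v)\<^sup>2 = 5 * (u\<^sup>2 + v\<^sup>2)"
    using assms by algebra+
  note * = this
  show ?case
    using 2 unfolding z norm_reps_def mem_Collect_eq prod.case * by simp
next
  case (3 z)
  then obtain x y u where z: "z = (x, y)" and n: "x\<^sup>2 + y\<^sup>2 = 5 * int m" and u: "x + 2 * e * y = 5 * u"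
    by (auto simp: norm_reps_def elim!: dvdE)
  define v where "v = y - 2 * e * u"
  have v: "y - 2 * e * x = 5 * v"
    using assms u unfolding v_def by algebra
  have "x = u - 2 * e * v" "y = 2 * e * u + v"
    using assms u v by algebra+
  note xy = this
  show ?case
    unfolding z prod.case u v using xy by simp
next
  case (4 z)
  then obtain x y u where z: "z = (x, y)" and n: "x\<^sup>2 + y\<^sup>2 = 5 * int m" and u: "x + 2 * e * y = 5 * u"
    by (auto simp: norm_reps_def elim!: dvdE)
  define v where "v = y - 2 * e * u"
  have v: "y - 2 * e * x = 5 * v"
    using assms u unfolding v_def by algebra
  have "5 * (u\<^sup>2 + v\<^sup>2) = x\<^sup>2 + y\<^sup>2"
    using assms u v by algebra
  with u v n show ?case
    by (simp add: z norm_reps_def)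
next
  case (5 z)
  then show ?case
    by (simp add: case_prod_unfold)
qed

text \<open>Only multiples of 1 + 2 i contribute: for any other pair the norm forces 5 to divide x -
  2 y. Multiplication by 1 + 2 i doubles the residue u - 2 v modulo 5, and 2 is a
  nonresidue.\<close>

lemma theta1_mult_5: "theta1 (5 * m) = - theta1 m"
proof -
  let ?f = "\<lambda>(u, v). parity_sign v * chi5 (u - 2 * v)"
  let ?P = "{(x, y)\<in>norm_reps (5 * m). 5 dvd x + 2 * 1 * y}"
  have "theta1 (5 * m) = sum ?f ?P"
    unfolding theta1_def
  proof (intro sum.mono_neutral_right finite_norm_reps ballI)
    fix z
    assume z: "z \<in> norm_reps (5 * m) - ?P"
    obtain x y where xy: "z = (x, y)" by force
    have "chi5 (x - 2 * y) * chi5 (x + 2 * y) = 0"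
      using z chi5_norm[of x y "5 * int m"] by (simp add: xy norm_reps_def chi5_eq_0_iff)
    then show "?f z = 0"
      using z chi5_eq_0_iff[of "x + 2 * y"] by (simp add: xy)
  qed auto
  also have "\<dots> = (\<Sum>(u, v)\<in>norm_reps m. parity_sign (2 * 1 * u + v) *
      chi5 (u - 2 * 1 * v - 2 * (2 * 1 * u + v)))"
    by (rule sum_norm_reps_mult_5) simp
  also have "\<dots> = (\<Sum>z\<in>norm_reps m. - ?f z)"
  proof (rule sum.cong, goal_cases)
    case (2 z)
    obtain u v where z: "z = (u, v)" by force
    have "chi5 (u - 2 * 1 * v - 2 * (2 * 1 * u + v)) = chi5 (2 * (u - 2 * v))"
      by (rule chi5_cong) (simp add: cong_iff_dvd_diff algebra_simps)
    then show ?case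
      using chi5_double[of "u - 2 * v"] by (simp add: z parity_sign_def)
  qed simp
  also have "\<dots> = - theta1 m"
    by (simp add: theta1_def sum_negf)
  finally show ?thesis .
qed

text \<open>Every Gaussian integer of norm 5 m is a multiple of 1 + 2 i or of 1 - 2 i. Those that
  are both have coordinates divisible by 5 and drop out modulo 25; the rest gives the factor (1 + 2
  i)^2 + (1 - 2 i)^2 = -6.\<close>

lemma theta3_mult_5: "25 dvd theta3 (5 * m) + 6 * theta3 m"
proof -
  let ?N = "norm_reps (5 * m)"
  let ?f = "\<lambda>(u, v). parity_sign v * (u\<^sup>2 - v\<^sup>2)"
  let ?g = "\<lambda>e (u, v). parity_sign (2 * e * u + v) * ((u - 2 * e * v)\<^sup>2 - (2 * e * u + v)\<^sup>2)"
  define P where "P e = {(x, y)\<in>?N. 5 dvd x + 2 * e * y}" for e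
  have fin: "finite (P e)" for e
    unfolding P_def by (rule finite_subset[OF _ finite_norm_reps[of "5 * m"]]) auto
  have "?N = P 1 \<union> P (- 1)"
  proof -
    have "5 dvd x + 2 * y \<or> 5 dvd x - 2 * y" if "(x, y) \<in> ?N" for x y
      using that chi5_norm[of x y "5 * int m"] by (simp add: norm_reps_def flip: chi5_eq_0_iff)
         (metis chi5_eq_0_iff dvd_triv_left mult_eq_0_iff)
    then show ?thesis
      by (auto simp: P_def)
  qed
  then have "theta3 (5 * m) + sum ?f (P 1 \<inter> P (- 1)) = sum ?f (P 1) + sum ?f (P (- 1))"
    unfolding theta3_def using sum.union_inter[OF fin fin, of ?f 1 "- 1"] by simp
  moreover have "25 dvd sum ?f (P 1 \<inter> P (- 1))"
  proof (rule dvd_sum, clarify)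
    fix x y :: int
    assume "(x, y) \<in> P 1" "(x, y) \<in> P (- 1)"
    then have "5 dvd x + 2 * y" "5 dvd x - 2 * y"
      by (auto simp: P_def)
    then have "5 dvd x" "5 dvd y"
      by presburger+
    then obtain x' y' where "x = 5 * x'" "y = 5 * y'"
      by (elim dvdE)
    then have "parity_sign y * (x\<^sup>2 - y\<^sup>2) = 25 * (parity_sign y * (x'\<^sup>2 - y'\<^sup>2))"
      by (simp add: power2_eq_square algebra_simps)
    then show "25 dvd parity_sign y * (x\<^sup>2 - y\<^sup>2)"
      by (rule dvdI)
  qed
  moreover have "sum ?f (P e) = sum (?g e) (norm_reps m)" if "e * e = 1" for e
    unfolding P_def using sum_norm_reps_mult_5[OF that] by simp
  moreover have "sum (?g 1) (norm_reps m) + sum (?g (- 1)) (norm_reps m) = - 6 * theta3 m"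
    unfolding theta3_def sum_distrib_left sum.distrib[symmetric]
    by (rule sum.cong) (auto simp: algebra_simps power2_eq_square parity_sign_def)
  ultimately have "theta3 (5 * m) + 6 * theta3 m = - sum ?f (P 1 \<inter> P (- 1))" "25 dvd sum ?f (P 1 \<inter> P (- 1))"
    by simp_all
  then show ?thesis
    by (simp only: dvd_minus_iff)
qed

text \<open>Descent on the power of 5 in m: by the two preceding lemmas, dividing m by 5 preserves
  divisibility of either count, as 6 is a unit modulo 25.\<close>

lemma dvd_theta1:
  assumes "m > 0" and "25 dvd theta3 m"
  shows "25 dvd theta1 m"
  using assms
proof (induction m rule: less_induct)
  case (less m)
  show ?case
  proof (cases "5 dvd m")
    case False
    then show ?thesis
      using less.prems(2) by (rule dvd_theta1_coprime)
  next
    case True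
    then obtain k where k: "m = 5 * k" ..
    have "25 dvd 6 * theta3 k"
      using theta3_mult_5[of k] less.prems(2) unfolding k by (simp only: dvd_add_right_iff)
    then have "25 dvd theta3 k"
      by presburger
    then have "25 dvd theta1 k"
      using less by (simp add: k)
    then show ?thesis
      unfolding k theta1_mult_5 by simp
  qed
qed

section \<open>The q-binomial theorem\<close>

text \<open>Gaussian binomials by a q-Pascal rule, without division, so that they exist in every
  commutative ring.\<close>

fun qbinom :: "'a::comm_ring_1 \<Rightarrow> nat \<Rightarrow> nat \<Rightarrow> 'a" where
  "qbinom p n 0 = 1"
| "qbinom p 0 (Suc k) = 0"
| "qbinom p (Suc n) (Suc k) = qbinom p n (Suc k) + p ^ (n - k) * qbinom p n k"

definition qpoch :: "'a::comm_ring_1 \<Rightarrow> nat \<Rightarrow> 'a" where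
  "qpoch p n = (\<Prod>i<n. 1 - p ^ Suc i)"

lemma qpoch_0 [simp]: "qpoch p 0 = 1"
  and qpoch_Suc: "qpoch p (Suc n) = qpoch p n * (1 - p ^ Suc n)"
  by (simp_all add: qpoch_def)

lemma qbinom_eq_0: "n < k \<Longrightarrow> qbinom p n k = 0"
  by (induction p n k rule: qbinom.induct) auto

lemma qbinom_qpoch: "k \<le> n \<Longrightarrow> qbinom p n k * qpoch p k * qpoch p (n - k) = qpoch p n"
proof (induction p n k rule: qbinom.induct)
  case (3 p n k)
  have k: "qbinom p n k * qpoch p k * qpoch p (n - k) = qpoch p n"
    using 3 by simp
  \<comment> \<open>The factor \<open>1 - p ^ (n - k)\<close> covers \<open>k = n\<close> as well,
    where both sides vanish.\<close>
  have Suc_k: "qbinom p n (Suc k) * qpoch p (Suc k) * qpoch p (n - k) = qpoch p n * (1 - p ^ (n - k))"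
  proof (cases "k = n")
    case True
    then show ?thesis
      by (simp add: qbinom_eq_0)
  next
    case False
    then have "n - k = Suc (n - Suc k)"
      using 3 by simp
    then show ?thesis
      using 3 False by (simp add: qpoch_Suc[of _ "n - Suc k"] mult.assoc[symmetric])
  qed
  have "qbinom p (Suc n) (Suc k) * qpoch p (Suc k) * qpoch p (Suc n - Suc k) =
      qbinom p n (Suc k) * qpoch p (Suc k) * qpoch p (n - k) +
      p ^ (n - k) * (qbinom p n k * qpoch p k * qpoch p (n - k)) * (1 - p ^ Suc k)"
    by (simp add: qpoch_Suc algebra_simps)
  also have "\<dots> = qpoch p n * (1 - p ^ (n - k) * p ^ Suc k)"
    unfolding k Suc_k by (simp add: algebra_simps)
  also have "p ^ (n - k) * p ^ Suc k = p ^ Suc n"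
    using 3 by (simp only: power_add[symmetric]) simp
  finally show ?case
    by (simp add: qpoch_Suc)
qed auto

text \<open>The q-binomial theorem with an auxiliary polynomial variable, kept so that the product
  can be both evaluated and differentiated at 1.\<close>

lemma coeff_qprod:
  fixes p y :: "'a::comm_ring_1"
  shows "coeff (\<Prod>i<M. [:y, - (p ^ i):]) k = (- 1) ^ k * p ^ (k choose 2) * qbinom p M k * y ^ (M - k)"
proof (induction M arbitrary: k)
  case 0
  then show ?case
    by (cases k) (auto simp: numeral_2_eq_2)
next
  case (Suc M)
  let ?Q = "\<Prod>i<M. [:y, - (p ^ i):]"
  have Q: "(\<Prod>i<Suc M. [:y, - (p ^ i):]) = smult y ?Q + pCons 0 (smult (- (p ^ M)) ?Q)"
    by (simp add: mult.commute)
  show ?case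
  proof (cases k)
    case 0
    then show ?thesis
      unfolding Q by (simp add: Suc numeral_2_eq_2)
  next
    case (Suc l)
    have ch: "Suc l choose 2 = l + (l choose 2)"
      by (simp add: numeral_2_eq_2)
    have e1: "p ^ M * qbinom p M l = p ^ (M - l) * qbinom p M l * p ^ l"
    proof (cases "l \<le> M")
      case True
      then have "p ^ M = p ^ (M - l) * p ^ l"
        by (simp flip: power_add)
      then show ?thesis
        by (simp add: mult_ac)
    qed (simp add: qbinom_eq_0)
    have e2: "y * (qbinom p M (Suc l) * y ^ (M - Suc l)) = qbinom p M (Suc l) * y ^ (M - l)"
    proof (cases "l < M")
      case True
      then have "y ^ (M - l) = y * y ^ (M - Suc l)"
        by (metis Suc_diff_Suc power_Suc)
      then show ?thesis
        by (simp add: mult_ac)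
    qed (simp add: qbinom_eq_0)
    have "coeff (\<Prod>i<Suc M. [:y, - (p ^ i):]) (Suc l) =
        (- 1) ^ Suc l * p ^ (Suc l choose 2) * (y * (qbinom p M (Suc l) * y ^ (M - Suc l))) +
        (- 1) ^ Suc l * p ^ (l choose 2) * (p ^ M * qbinom p M l) * y ^ (M - l)"
      unfolding Q coeff_add coeff_pCons_Suc coeff_smult Suc.IH by (simp add: algebra_simps)
    also have "\<dots> = (- 1) ^ Suc l * p ^ (Suc l choose 2) * qbinom p (Suc M) (Suc l) * y ^ (Suc M - Suc l)"
      unfolding e1 e2 ch power_add by (simp add: algebra_simps)
    finally show ?thesis
      unfolding Suc .
  qed
qed

lemma degree_qprod:
  fixes p y :: "'a::comm_ring_1"
  shows "degree (\<Prod>i<M. [:y, - (p ^ i):]) \<le> M"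
  by (rule degree_le) (auto simp: coeff_qprod qbinom_eq_0)

lemma poly_1_conv_sum_coeff:
  fixes q :: "'a::comm_semiring_1 poly"
  assumes "degree q \<le> n"
  shows "poly q 1 = (\<Sum>k\<le>n. coeff q k)"
  unfolding poly_altdef using assms
  by (auto intro!: sum.mono_neutral_left le_degree)

lemma prod_diff_power:
  fixes p y :: "'a::comm_ring_1"
  shows "(\<Prod>i<M. y - p ^ i) = (\<Sum>k\<le>M. (- 1) ^ k * p ^ (k choose 2) * qbinom p M k * y ^ (M - k))"
proof -
  have "(\<Prod>i<M. y - p ^ i) = poly (\<Prod>i<M. [:y, - (p ^ i):]) 1"
    by (simp add: poly_prod)
  then show ?thesis
    using poly_1_conv_sum_coeff[OF degree_qprod, of y p M] by (simp add: coeff_qprod)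
qed

text \<open>In the product rule, every summand except the one that omits the index \<open>N\<close>
  contains the zero factor \<open>y - p ^ N\<close>.\<close>

lemma prod_diff_power_deriv:
  fixes p y :: "'a::idom"
  assumes "N < M" and "y = p ^ N"
  shows "- (p ^ N) * (\<Prod>i\<in>{..<M} - {N}. y - p ^ i) =
    (\<Sum>k\<le>M. of_nat k * ((- 1) ^ k * p ^ (k choose 2) * qbinom p M k * y ^ (M - k)))"
proof -
  let ?Q = "\<Prod>i<M. [:y, - (p ^ i):]"
  have "poly (pderiv ?Q) 1 = (\<Sum>i<M. (\<Prod>j\<in>{..<M} - {i}. y - p ^ j) * - (p ^ i))"
    by (simp add: pderiv_prod poly_sum poly_prod pderiv_pCons mult.commute)
  also have "\<dots> = (\<Sum>i\<in>{N}. (\<Prod>j\<in>{..<M} - {i}. y - p ^ j) * - (p ^ i))"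
    using assms by (intro sum.mono_neutral_right) auto
  finally have 1: "poly (pderiv ?Q) 1 = - (p ^ N) * (\<Prod>i\<in>{..<M} - {N}. y - p ^ i)"
    by simp
  have "degree (pderiv ?Q) \<le> M"
    by (rule degree_le) (auto simp: coeff_pderiv coeff_qprod qbinom_eq_0)
  then have "poly (pderiv ?Q) 1 = (\<Sum>k\<le>M. coeff (pderiv ?Q) k)"
    by (rule poly_1_conv_sum_coeff)
  also have "\<dots> = (\<Sum>k\<le>M. of_nat (Suc k) * coeff ?Q (Suc k))"
    by (simp only: coeff_pderiv)
  also have "\<dots> = (\<Sum>k\<le>Suc M. of_nat k * coeff ?Q k)"
    unfolding sum.atMost_Suc_shift by simp
  also have "\<dots> = (\<Sum>k\<le>M. of_nat k * coeff ?Q k)"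
    by (simp add: coeff_qprod qbinom_eq_0)
  finally show ?thesis
    unfolding 1 coeff_qprod .
qed

section \<open>Truncation of formal power series\<close>

text \<open>Agreement of low coefficients becomes a divisibility, so truncations can be handled by
  ring algebra.\<close>

lemma fps_X_power_dvd_iff:
  fixes f :: "'a::comm_ring_1 fps"
  shows "fps_X ^ n dvd f \<longleftrightarrow> (\<forall>i<n. fps_nth f i = 0)"
proof
  assume "\<forall>i<n. fps_nth f i = 0"
  then have "fps_cutoff n f = 0"
    by (simp add: fps_eq_iff)
  then have "f = fps_X ^ n * fps_shift n f"
    using fps_shift_cutoff'[of n f] by simp
  then show "fps_X ^ n dvd f"
    by (metis dvd_triv_left)
qed (auto simp: fps_X_power_mult_nth elim!: dvdE)

lemma fps_eq_by_truncation:
  fixes f g :: "'a::comm_ring_1 fps"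
  assumes "\<And>n. fps_X ^ n dvd f - g"
  shows "f = g"
proof (rule fps_ext)
  fix n
  show "fps_nth f n = fps_nth g n"
    using assms[of "Suc n"] by (simp add: fps_X_power_dvd_iff del: power_Suc)
qed

lemma dvd_diff_trans:
  fixes a b c d :: "'a::comm_ring_1"
  shows "d dvd a - b \<Longrightarrow> d dvd b - c \<Longrightarrow> d dvd a - c"
  using dvd_add[of d "a - b" "b - c"] by simp

lemma dvd_diff_mult:
  fixes a b c d e :: "'a::comm_ring_1"
  assumes "d dvd a - b" and "d dvd c - e"
  shows "d dvd a * c - b * e"
proof -
  have "a * c - b * e = (a - b) * c + b * (c - e)"
    by (simp add: algebra_simps)
  then show ?thesis
    using assms by simp
qed

lemma qpoch_trunc:
  assumes "c > 0" and "M \<le> M'"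
  shows "fps_X ^ Suc M dvd qpoch (fps_X ^ c) M' - (qpoch (fps_X ^ c) M :: 'a::comm_ring_1 fps)"
  using assms(2)
proof (induction M' rule: dec_induct)
  case (step M')
  have "Suc M \<le> c * Suc M'"
    using step(1) assms(1) by (metis Suc_le_mono One_nat_def Suc_leI le_trans mult_le_mono nat_mult_1)
  then have "fps_X ^ Suc M dvd (fps_X ^ c :: 'a fps) ^ Suc M'"
    by (simp only: power_mult[symmetric] le_imp_power_dvd)
  then have "fps_X ^ Suc M dvd qpoch (fps_X ^ c :: 'a fps) M' * (fps_X ^ c) ^ Suc M'"
    by (rule dvd_mult)
  with step.IH have "fps_X ^ Suc M dvd (qpoch (fps_X ^ c) M' - qpoch (fps_X ^ c) M) -
      qpoch (fps_X ^ c :: 'a fps) M' * (fps_X ^ c) ^ Suc M'"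
    by (rule dvd_diff)
  then show ?case
    unfolding qpoch_Suc by (simp only: right_diff_distrib mult_1_right diff_diff_eq add.commute)
qed simp

text \<open>Coefficientwise convergence means that each coefficient is eventually constant, and by
  \<open>qpoch_trunc\<close> those up to \<open>M\<close> no longer change after \<open>M\<close>
  factors.\<close>

lemma euler_trunc:
  assumes "c > 0"
  shows "fps_X ^ Suc M dvd euler_fps c - qpoch (fps_X ^ c) M"
proof -
  have lim: "(\<lambda>n. qpoch (fps_X ^ c) n) \<longlonglongrightarrow> euler_fps c"
    using has_prod_imp_tendsto'[OF has_prod_euler_fps[OF assms]]
    unfolding qpoch_def power_mult .
  have "fps_nth (euler_fps c) i = fps_nth (qpoch (fps_X ^ c) M) i" if "i < Suc M" for i
  proof -
    have "eventually (\<lambda>n. fps_nth (qpoch (fps_X ^ c) n) i = fps_nth (euler_fps c) i) sequentially"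
      using lim unfolding tendsto_fps_iff by blast
    then have "eventually (\<lambda>n. fps_nth (qpoch (fps_X ^ c) n) i = fps_nth (euler_fps c) i \<and> n \<ge> M) sequentially"
      using eventually_ge_at_top eventually_conj by blast
    then obtain n where "fps_nth (qpoch (fps_X ^ c) n) i = fps_nth (euler_fps c) i" "M \<le> n"
      by (auto simp: eventually_sequentially)
    then show ?thesis
      using qpoch_trunc[OF assms, of M n, where 'a = int] that by (simp add: fps_X_power_dvd_iff del: power_Suc)
  qed
  then show ?thesis
    by (simp add: fps_X_power_dvd_iff del: power_Suc)
qed

lemma euler_fps_nth_0: "c > 0 \<Longrightarrow> fps_nth (euler_fps c) 0 = 1"
  using euler_trunc[of c 0] fps_X_power_dvd_iff[of 1 "euler_fps c - 1"] by simp

text \<open>The Gaussian binomial tends to the inverse of the infinite product. As \<open>k\<close>,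
  \<open>M - k\<close> and \<open>M\<close> are all at least \<open>K\<close>, the three Pochhammer
  symbols in \<open>qbinom_qpoch\<close> may be replaced by \<open>euler_fps c\<close>, of which one
  factor cancels.\<close>

lemma qbinom_trunc:
  assumes "c > 0" and "K \<le> k" and "K + k \<le> M"
  shows "fps_X ^ Suc K dvd qbinom (fps_X ^ c) M k * euler_fps c - 1"
proof -
  let ?P = "euler_fps c" and ?B = "qbinom (fps_X ^ c :: int fps) M k" and ?q = "qpoch (fps_X ^ c :: int fps)"
  have P: "fps_X ^ Suc K dvd ?P - ?q L" if "K \<le> L" for L
    using euler_trunc[OF assms(1), of L] that
    by (meson Suc_le_mono dvd_trans le_imp_power_dvd)
  have "fps_X ^ Suc K dvd ?B * ?P * ?P - ?B * ?q k * ?q (M - k)"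
    using assms by (intro dvd_diff_mult P) auto
  also have "?B * ?q k * ?q (M - k) = ?q M"
    using assms by (intro qbinom_qpoch) simp
  finally have 1: "fps_X ^ Suc K dvd ?B * ?P * ?P - ?q M" .
  have "fps_X ^ Suc K dvd - (?P - ?q M)"
    unfolding dvd_minus_iff using assms by (intro P) simp
  then have "fps_X ^ Suc K dvd ?q M - ?P"
    by (simp only: minus_diff_eq)
  with 1 have "fps_X ^ Suc K dvd ?B * ?P * ?P - ?P"
    by (rule dvd_diff_trans)
  then have "fps_X ^ Suc K dvd fps_left_inverse ?P 1 * (?B * ?P * ?P - ?P)"
    by (rule dvd_mult)
  also have "fps_left_inverse ?P 1 * (?B * ?P * ?P - ?P) = (fps_left_inverse ?P 1 * ?P) * (?B * ?P - 1)"
    by (simp only: algebra_simps mult_1_left)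
  also have "fps_left_inverse ?P 1 * ?P = 1"
    using euler_fps_nth_0[OF assms(1)] by (intro fps_left_inverse) simp
  finally show ?thesis
    by simp
qed

section \<open>Theta series\<close>

text \<open>
  With the weight \<open>(-1)\<^sup>j\<close> the series \<open>theta_fps c a\<close> is \<open>f(-q\<^sup>a, -q\<^bsup>c - a\<^esup>)\<close>. The truncation by \<open>nat\<close> is
  harmless for \<open>a \<le> c\<close>, and the sum over a fibre is then finite.
\<close>
definition theta_exp :: "nat \<Rightarrow> nat \<Rightarrow> int \<Rightarrow> nat" where
  "theta_exp c a j = nat (int c * (j * (j + 1) div 2) - int a * j)"

definition theta_fps :: "nat \<Rightarrow> nat \<Rightarrow> (int \<Rightarrow> int) \<Rightarrow> int fps" where
  "theta_fps c a w = Abs_fps (\<lambda>n. \<Sum>j | theta_exp c a j = n. w j)"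

lemma triangular_double: "2 * (j * (j + 1) div 2) = j * (j + 1)" for j :: int
  by simp

text \<open>This makes the fibres of the exponent finite and compensates for the precision that
  \<open>qbinom_trunc\<close> loses away from the central index. For j \<ge> 0 replace
  \<open>a\<close> by \<open>c\<close>; otherwise drop the term in \<open>a\<close>.\<close>

lemma theta_exp_ge:
  assumes "c > 0" and "a \<le> c"
  shows "int c * (j * (j + 1) div 2) - int a * j \<ge> \<bar>j\<bar> - 1"
proof (cases "j \<ge> 0")
  case True
  define S where "S = j * (j + 1) div 2"
  define S' where "S' = j * (j - 1) div 2"
  have S': "S' = S - j"
    using triangular_double[of j] triangular_double[of "j - 1"] by (simp add: S_def S'_def algebra_simps)
  have "0 \<le> j * (j - 1)"
    using True by (cases "j = 0") auto
  then have "1 * S' \<le> int c * S'"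
    using assms(1) by (intro mult_right_mono) (auto simp: S'_def)
  moreover have "0 \<le> (j - 1) * (j - 2)"
    using True by (cases "j = 0 \<or> j = 1") auto
  then have "j - 1 \<le> S'"
    using triangular_double[of "j - 1"] by (simp add: S'_def algebra_simps)
  moreover have "int a * j \<le> int c * j"
    using assms(2) True by (intro mult_right_mono) auto
  moreover have "int c * S' = int c * S - int c * j"
    by (simp add: S' right_diff_distrib)
  ultimately have "\<bar>j\<bar> - 1 \<le> int c * S - int a * j"
    using True by linarith
  then show ?thesis
    by (simp only: S_def)
next
  case False
  have "0 \<le> (j + 1) * (j + 2)"
    using False by (cases "j = - 1") (auto intro: mult_nonpos_nonpos)
  then have "- j - 1 \<le> j * (j + 1) div 2"
    using triangular_double[of j] by (simp add: algebra_simps)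
  moreover from this have "1 * (j * (j + 1) div 2) \<le> int c * (j * (j + 1) div 2)"
    using assms False by (intro mult_right_mono) auto
  moreover have "int a * j \<le> 0"
    using False by (simp add: mult_nonneg_nonpos)
  ultimately show ?thesis
    using False by linarith
qed

lemma int_theta_exp:
  assumes "c > 0" and "a \<le> c"
  shows "int (theta_exp c a j) = int c * (j * (j + 1) div 2) - int a * j"
proof -
  have "int c * (j * (j + 1) div 2) - int a * j \<ge> 0"
    using theta_exp_ge[OF assms, of j] by (cases "j = 0") auto
  then show ?thesis
    by (simp add: theta_exp_def)
qed

lemma abs_le_theta_exp:
  assumes "c > 0" and "a \<le> c"
  shows "\<bar>j\<bar> \<le> int (theta_exp c a j) + 1"
  using theta_exp_ge[OF assms, of j] int_theta_exp[OF assms, of j] by linarith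

lemma theta_exp_fibre:
  assumes "c > 0" and "a \<le> c"
  shows "{j. theta_exp c a j = n} \<subseteq> {- int n - 1..int n + 1}"
proof clarify
  fix j
  show "j \<in> {- int (theta_exp c a j) - 1..int (theta_exp c a j) + 1}"
    using abs_le_theta_exp[OF assms, of j] by auto
qed

lemma finite_theta_exp_fibre:
  assumes "c > 0" and "a \<le> c"
  shows "finite {j. theta_exp c a j = n}"
  using theta_exp_fibre[OF assms] finite_subset by blast

lemma theta_trunc:
  assumes "c > 0" and "a \<le> c" and "finite J" and "{- int N..int N} \<subseteq> J"
  shows "fps_X ^ N dvd (\<Sum>j\<in>J. of_int (w j) * fps_X ^ theta_exp c a j) - theta_fps c a w"
  unfolding fps_X_power_dvd_iff
proof (intro allI impI)
  fix n assume n: "n < N"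
  have "fps_nth (\<Sum>j\<in>J. of_int (w j) * fps_X ^ theta_exp c a j) n = (\<Sum>j\<in>J. if theta_exp c a j = n then w j else 0)"
    unfolding fps_sum_nth by (intro sum.cong refl) (auto simp: fps_of_int[symmetric])
  also have "\<dots> = (\<Sum>j\<in>J \<inter> {j. theta_exp c a j = n}. w j)"
    using assms(3) by (simp add: sum.If_cases)
  \<comment> \<open>The fibre reaches up to absolute value n + 1, which is at most \<open>N\<close>
    because n < N.\<close>
  also have "J \<inter> {j. theta_exp c a j = n} = {j. theta_exp c a j = n}"
    using theta_exp_fibre[OF assms(1,2), of n] assms(4) n by fastforce
  finally show "fps_nth ((\<Sum>j\<in>J. of_int (w j) * fps_X ^ theta_exp c a j) - theta_fps c a w) n = 0"
    by (simp add: theta_fps_def)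
qed

lemma parity_sign_power: "parity_sign (int N - int k) = (- 1) ^ N * (- 1) ^ k"
  by (auto simp: parity_sign_def simp flip: minus_one_power_iff power_add)

text \<open>The passage to the limit in both finite identities: the even \<open>M\<close> serves the
  triple product, the odd one Jacobi's identity.\<close>

lemma qbinom_sum_trunc:
  assumes "c > 0" and "a \<le> c" and "M = 2 * N \<or> M = 2 * N + 1"
  shows "fps_X ^ N dvd
    (\<Sum>k\<le>M. of_int (w (int N - int k)) * fps_X ^ theta_exp c a (int N - int k) * qbinom (fps_X ^ c) M k) * euler_fps c
      - theta_fps c a w"
proof (rule dvd_diff_trans)
  let ?P = "euler_fps c"
  let ?B = "\<lambda>k. qbinom (fps_X ^ c) M k :: int fps"
  let ?j = "\<lambda>k. int N - int k"
  let ?t = "\<lambda>j. of_int (w j) * fps_X ^ theta_exp c a j :: int fps"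
  have "(\<Sum>k\<le>M. ?t (?j k) * ?B k) * ?P - (\<Sum>k\<le>M. ?t (?j k)) = (\<Sum>k\<le>M. ?t (?j k) * (?B k * ?P - 1))"
    unfolding sum_distrib_right sum_subtractf[symmetric] by (simp only: right_diff_distrib mult_1_right mult.assoc)
  also have "fps_X ^ N dvd \<dots>"
  proof (rule dvd_sum)
    fix k assume k: "k \<in> {..M}"
    let ?K = "min k (M - k)"
    have "fps_X ^ Suc ?K dvd ?B k * ?P - 1"
      using assms k by (intro qbinom_trunc) auto
    then have "fps_X ^ theta_exp c a (?j k) * fps_X ^ Suc ?K dvd fps_X ^ theta_exp c a (?j k) * (?B k * ?P - 1)"
      by (intro mult_dvd_mono dvd_refl)
    \<comment> \<open>The index is off centre by |N - k|, which costs that much precision; the theta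
      exponent restores all but 1 of it, and \<open>Suc\<close> the rest.\<close>
    moreover have "N \<le> theta_exp c a (?j k) + Suc ?K"
      using abs_le_theta_exp[OF assms(1,2), of "?j k"] assms(3) k by auto
    ultimately have "fps_X ^ N dvd fps_X ^ theta_exp c a (?j k) * (?B k * ?P - 1)"
      unfolding power_add[symmetric] using le_imp_power_dvd dvd_trans by blast
    then show "fps_X ^ N dvd ?t (?j k) * (?B k * ?P - 1)"
      by (simp only: mult.assoc dvd_mult)
  qed
  finally show "fps_X ^ N dvd (\<Sum>k\<le>M. ?t (?j k) * ?B k) * ?P - (\<Sum>k\<le>M. ?t (?j k))" .
  have "(\<Sum>k\<le>M. ?t (?j k)) = (\<Sum>j\<in>?j ` {..M}. ?t j)"
    by (subst sum.reindex) (auto simp: inj_on_def)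
  also have "fps_X ^ N dvd \<dots> - theta_fps c a w"
  proof (rule theta_trunc[OF assms(1,2)])
    show "{- int N..int N} \<subseteq> ?j ` {..M}"
    proof
      fix j assume "j \<in> {- int N..int N}"
      then show "j \<in> ?j ` {..M}"
        using assms(3) by (intro image_eqI[of _ _ "nat (int N - j)"]) auto
    qed
  qed simp
  finally show "fps_X ^ N dvd (\<Sum>k\<le>M. ?t (?j k)) - theta_fps c a w" .
qed

section \<open>Finite forms of the triple product and of Jacobi's identity\<close>

lemma prod_power_choose_2: "(\<Prod>i<N. p ^ i) = p ^ (N choose 2)" for p :: "'a::comm_monoid_mult"
  by (induction N) (auto simp: numeral_2_eq_2 power_add mult.commute)

lemma int_choose_2: "2 * int (n choose 2) = int n * (int n - 1)"
  by (induction n) (auto simp: numeral_2_eq_2 algebra_simps)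

lemma prod_lessThan_add: "(\<Prod>i<m + n. f i) = (\<Prod>i<m. f i) * (\<Prod>i<n. f (m + i))"
  for f :: "nat \<Rightarrow> 'a::comm_monoid_mult"
  by (induction n) (auto simp: mult_ac)

text \<open>
  This is the q-binomial theorem for \<open>p = q\<^sup>c\<close> and \<open>y = q\<^bsup>c N - a\<^esup>\<close>, both sides of which are divisible
  by \<open>q\<^sup>E\<close>.
\<close>
lemma finite_triple_product:
  assumes "0 < a" and "a < c"
  shows "(\<Prod>i<N. (1 - fps_X ^ (c * i + a)) * (1 - fps_X ^ (c * i + (c - a)))) =
    (\<Sum>k\<le>2 * N. of_int (parity_sign (int N - int k)) * fps_X ^ theta_exp c a (int N - int k) *
       qbinom (fps_X ^ c) (2 * N) k :: int fps)"
proof -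
  let ?p = "fps_X ^ c :: int fps"
  define s where "s = c * N - a"
  let ?y = "fps_X ^ s :: int fps"
  define E where "E = c * (N choose 2) + s * N"
  have split: "(\<Prod>i<2 * N. ?y - ?p ^ i) = (\<Prod>i<N. ?y - ?p ^ i) * (\<Prod>i<N. ?y - ?p ^ (N + i))"
    unfolding mult_2 by (rule prod_lessThan_add)
  \<comment> \<open>Reversing the order lets the exponents \<open>c * i + (c - a)\<close> increase
    with \<open>i\<close> once a power of \<open>?p\<close> is extracted.\<close>
  have "(\<Prod>i<N. ?y - ?p ^ i) = (\<Prod>i<N. ?y - ?p ^ (N - Suc i))"
    by (rule prod.nat_diff_reindex[symmetric])
  also have "\<dots> = (\<Prod>i<N. - 1 * ?p ^ (N - Suc i) * (1 - fps_X ^ (c * i + (c - a))))"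
  proof (rule prod.cong[OF refl])
    fix i assume "i \<in> {..<N}"
    then obtain d where "N = Suc i + d"
      using less_iff_Suc_add by auto
    then have "c * (N - Suc i) + (c * i + (c - a)) = s"
      using assms by (simp add: s_def algebra_simps)
    then show "?y - ?p ^ (N - Suc i) = - 1 * ?p ^ (N - Suc i) * (1 - fps_X ^ (c * i + (c - a)))"
      by (simp add: algebra_simps flip: power_add power_mult)
  qed
  also have "\<dots> = (- 1) ^ N * ?p ^ (N choose 2) * (\<Prod>i<N. 1 - fps_X ^ (c * i + (c - a)))"
    unfolding prod.distrib prod.nat_diff_reindex[of "\<lambda>i. ?p ^ i"] prod_power_choose_2 by simp
  finally have left: "(\<Prod>i<N. ?y - ?p ^ i) = (- 1) ^ N * ?p ^ (N choose 2) * (\<Prod>i<N. 1 - fps_X ^ (c * i + (c - a)))" .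
  have "(\<Prod>i<N. ?y - ?p ^ (N + i)) = (\<Prod>i<N. ?y * (1 - fps_X ^ (c * i + a)))"
  proof (rule prod.cong[OF refl])
    fix i assume "i \<in> {..<N}"
    then have "c * 1 \<le> c * N"
      by (intro mult_le_mono2) auto
    then have "a \<le> c * N"
      using assms(2) by linarith
    then have "s + (c * i + a) = c * (N + i)"
      by (simp add: s_def algebra_simps)
    then show "?y - ?p ^ (N + i) = ?y * (1 - fps_X ^ (c * i + a))"
      by (simp add: algebra_simps flip: power_add power_mult)
  qed
  also have "\<dots> = ?y ^ N * (\<Prod>i<N. 1 - fps_X ^ (c * i + a))"
    by (simp add: prod.distrib)
  finally have right: "(\<Prod>i<N. ?y - ?p ^ (N + i)) = ?y ^ N * (\<Prod>i<N. 1 - fps_X ^ (c * i + a))" .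
  have "(- 1) ^ N * fps_X ^ E * (\<Prod>i<N. (1 - fps_X ^ (c * i + a)) * (1 - fps_X ^ (c * i + (c - a)))) = (\<Prod>i<2 * N. ?y - ?p ^ i)"
    unfolding split left right E_def prod.distrib power_add[of _ "c * (N choose 2)"] power_mult
    by (simp only: mult_ac)
  also have "\<dots> = (\<Sum>k\<le>2 * N. (- 1) ^ k * fps_X ^ (c * (k choose 2) + s * (2 * N - k)) * qbinom ?p (2 * N) k)"
    unfolding prod_diff_power by (simp add: power_add power_mult mult_ac)
  also have "\<dots> = (\<Sum>k\<le>2 * N. (- 1) ^ N * fps_X ^ E * (of_int (parity_sign (int N - int k)) * fps_X ^ theta_exp c a (int N - int k) * qbinom ?p (2 * N) k))"
  proof (rule sum.cong[OF refl])
    fix k assume "k \<in> {..2 * N}"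
    have "c * (k choose 2) + s * (2 * N - k) = E + theta_exp c a (int N - int k)"
    \<comment> \<open>For \<open>N = 0\<close> the truncated difference \<open>s\<close> is 0
      instead of -a, so this case is separate.\<close>
    proof (cases "N = 0")
      case False
      let ?j = "int N - int k"
      have "c * 1 \<le> c * N"
        using False by (intro mult_le_mono2) auto
      then have "a \<le> c * N"
        using assms(2) by linarith
      then have s: "int s = int c * int N - int a"
        by (simp add: s_def of_nat_diff)
      have "2 * (int c * int (k choose 2) + int s * (2 * int N - int k)) =
          2 * (int c * int (N choose 2) + int s * int N + (int c * (?j * (?j + 1) div 2) - int a * ?j))"
        using int_choose_2[of k] int_choose_2[of N] triangular_double[of ?j] unfolding s by algebra
      then have "int (c * (k choose 2) + s * (2 * N - k)) = int (E + theta_exp c a ?j)"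
        using int_theta_exp[of c a ?j] assms \<open>k \<in> {..2 * N}\<close> by (simp add: E_def of_nat_diff)
      then show ?thesis
        by (simp only: of_nat_eq_iff)
    qed (use \<open>k \<in> {..2 * N}\<close> in \<open>simp add: E_def theta_exp_def\<close>)
    then show "(- 1) ^ k * fps_X ^ (c * (k choose 2) + s * (2 * N - k)) * qbinom ?p (2 * N) k =
       (- 1) ^ N * fps_X ^ E * (of_int (parity_sign (int N - int k)) * fps_X ^ theta_exp c a (int N - int k) * qbinom ?p (2 * N) k)"
      by (simp add: parity_sign_power power_add)
  qed
  finally show ?thesis
    by (simp only: sum_distrib_left[symmetric]) simp
qed

text \<open>
  For \<open>y = q\<^sup>N\<close> the product in the q-binomial theorem contains a vanishing factor, so that its derivative
  reduces to a single product; a multiple of the vanishing value of the product turns the weight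
  \<open>k\<close> of the derivative into the symmetric weight \<open>2 j + 1\<close> with \<open>j = N - k\<close>.
\<close>
lemma finite_jacobi:
  "2 * (qpoch fps_X N)\<^sup>2 = (\<Sum>k\<le>2 * N + 1. of_int (parity_sign (int N - int k) * (2 * (int N - int k) + 1)) *
     fps_X ^ theta_exp 1 0 (int N - int k) * qbinom (fps_X ^ 1) (2 * N + 1) k :: int fps)"
proof -
  let ?p = "fps_X :: int fps"
  let ?y = "?p ^ N"
  let ?M = "2 * N + 1"
  \<comment> \<open>The three terms come from the factors below index \<open>N\<close>, from those
    above it, and from the factor \<open>?p ^ N\<close> of the derivative.\<close>
  define E where "E = (N choose 2) + N * N + N"
  define u where "u k = (- 1) ^ k * ?p ^ (k choose 2) * qbinom ?p ?M k * ?y ^ (?M - k)" for k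
  have u: "u k = (- 1) ^ N * ?p ^ E * (of_int (parity_sign (int N - int k)) * ?p ^ theta_exp 1 0 (int N - int k) * qbinom ?p ?M k)"
    if "k \<le> ?M" for k
  proof -
    let ?j = "int N - int k"
    have "2 * (int (k choose 2) + int N * (1 + 2 * int N - int k)) =
        2 * (int (N choose 2) + int N * int N + int N + ?j * (?j + 1) div 2)"
      using int_choose_2[of k] int_choose_2[of N] triangular_double[of ?j] by algebra
    then have "int (k choose 2) + int N * (1 + 2 * int N - int k) =
        int (N choose 2) + int N * int N + int N + ?j * (?j + 1) div 2"
      by (simp only: mult_cancel_left) simp
    then have "int ((k choose 2) + N * (?M - k)) = int (E + theta_exp 1 0 ?j)"
      using int_theta_exp[of 1 0 ?j] that by (simp add: E_def of_nat_diff)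
    then have "(k choose 2) + N * (?M - k) = E + theta_exp 1 0 ?j"
      by (simp only: of_nat_eq_iff)
    moreover have "u k = (- 1) ^ k * ?p ^ ((k choose 2) + N * (?M - k)) * qbinom ?p ?M k"
      unfolding u_def by (simp add: power_add power_mult mult_ac)
    ultimately show ?thesis
      by (simp add: parity_sign_power power_add)
  qed
  have 0: "(\<Sum>k\<le>?M. u k) = 0"
    unfolding u_def prod_diff_power[symmetric] by (auto intro!: bexI[of _ N])
  have 1: "(\<Sum>k\<le>?M. of_nat k * u k) = - (?p ^ N) * (\<Prod>i\<in>{..<?M} - {N}. ?y - ?p ^ i)"
    unfolding u_def by (rule prod_diff_power_deriv[symmetric]) auto
  have "(\<Prod>i\<in>{..<?M} - {N}. ?y - ?p ^ i) = (\<Prod>i<N. ?y - ?p ^ i) * (\<Prod>i<N. ?y - ?p ^ (Suc N + i))"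
  proof -
    have "{..<?M} - {N} = {..<N} \<union> {Suc N..<?M}" "{..<N} \<inter> {Suc N..<?M} = {}"
      by auto
    moreover have "(\<Prod>i\<in>{Suc N..<?M}. ?y - ?p ^ i) = (\<Prod>i<N. ?y - ?p ^ (Suc N + i))"
      by (rule prod.reindex_bij_witness[of _ "\<lambda>i. Suc N + i" "\<lambda>i. i - Suc N"]) auto
    ultimately show ?thesis
      by (simp add: prod.union_disjoint)
  qed
  also have "(\<Prod>i<N. ?y - ?p ^ i) = (\<Prod>i<N. ?y - ?p ^ (N - Suc i))"
    by (rule prod.nat_diff_reindex[symmetric])
  also have "\<dots> = (\<Prod>i<N. - 1 * ?p ^ (N - Suc i) * (1 - ?p ^ Suc i))"
    by (rule prod.cong) (auto simp: algebra_simps simp flip: power_add power_Suc)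
  also have "\<dots> = (- 1) ^ N * ?p ^ (N choose 2) * qpoch ?p N"
    unfolding prod.distrib prod.nat_diff_reindex[of "\<lambda>i. ?p ^ i"] prod_power_choose_2 qpoch_def by simp
  also have "(\<Prod>i<N. ?y - ?p ^ (Suc N + i)) = (\<Prod>i<N. ?y * (1 - ?p ^ Suc i))"
    by (rule prod.cong) (auto simp: algebra_simps power_add)
  also have "\<dots> = ?y ^ N * qpoch ?p N"
    by (simp add: prod.distrib qpoch_def)
  finally have "(\<Sum>k\<le>?M. of_nat k * u k) = - ((- 1) ^ N * ?p ^ E * (qpoch ?p N)\<^sup>2)"
    unfolding 1 E_def by (simp add: power_add power_mult power2_eq_square mult_ac)
  then have "(- 1) ^ N * ?p ^ E * (2 * (qpoch ?p N)\<^sup>2) = of_int (2 * int N + 1) * (\<Sum>k\<le>?M. u k) - 2 * (\<Sum>k\<le>?M. of_nat k * u k)"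
    unfolding 0 by simp
  also have "\<dots> = (\<Sum>k\<le>?M. of_int (2 * (int N - int k) + 1) * u k)"
    unfolding sum_distrib_left sum_subtractf[symmetric] by (rule sum.cong) (auto simp: algebra_simps)
  also have "\<dots> = (- 1) ^ N * ?p ^ E * (\<Sum>k\<le>?M. of_int (parity_sign (int N - int k) * (2 * (int N - int k) + 1)) *
     ?p ^ theta_exp 1 0 (int N - int k) * qbinom (?p ^ 1) ?M k)"
    unfolding sum_distrib_left by (rule sum.cong) (simp_all add: u mult_ac del: of_int_add of_int_diff)
  finally show ?thesis
    by simp
qed

section \<open>The coefficients of the two eta products\<close>

lemma theta_fps_triple_trunc:
  assumes "0 < a" and "a < c"
  shows "fps_X ^ N dvd (\<Prod>i<N. (1 - fps_X ^ (c * i + a)) * (1 - fps_X ^ (c * i + (c - a)))) * euler_fps c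
    - theta_fps c a parity_sign"
  unfolding finite_triple_product[OF assms] using assms by (intro qbinom_sum_trunc) auto

text \<open>The factors are sorted by their exponents modulo 5.\<close>

lemma qpoch_mult_5:
  fixes x :: "'a::comm_ring_1"
  shows "qpoch x (5 * N) = qpoch (x ^ 5) N *
    ((\<Prod>i<N. (1 - x ^ (5 * i + 1)) * (1 - x ^ (5 * i + 4))) * (\<Prod>i<N. (1 - x ^ (5 * i + 2)) * (1 - x ^ (5 * i + 3))))"
proof (induction N)
  case (Suc N)
  have "5 * Suc N = Suc (Suc (Suc (Suc (Suc (5 * N)))))"
    by simp
  moreover have "(x ^ 5) ^ Suc N = x ^ (5 * N + 5)"
    by (simp add: power_add flip: power_mult)
  ultimately show ?case
    by (simp only: qpoch_Suc Suc prod.lessThan_Suc) (simp add: mult_ac eval_nat_numeral)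
qed simp

text \<open>Each of the residue pairs 1, 4 and 2, 3 needs one copy of \<open>euler_fps 5\<close> to
  complete a triple product: one copy sits inside \<open>euler_fps 1\<close>, the other is the
  second factor.\<close>

lemma euler_1_mult_euler_5:
  "euler_fps 1 * euler_fps 5 = theta_fps 5 1 parity_sign * theta_fps 5 2 parity_sign"
proof (rule fps_eq_by_truncation)
  fix N
  let ?X = "fps_X :: int fps"
  let ?d = "\<lambda>f g. ?X ^ N dvd f - g"
  let ?P = "euler_fps 5"
  let ?A = "\<Prod>i<N. (1 - ?X ^ (5 * i + 1)) * (1 - ?X ^ (5 * i + 4))"
  let ?B = "\<Prod>i<N. (1 - ?X ^ (5 * i + 2)) * (1 - ?X ^ (5 * i + 3))"
  have trunc: "?d (euler_fps c) (qpoch (?X ^ c) M)" if "c > 0" "N \<le> M" for c M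
    using euler_trunc[OF that(1), of M] that(2) by (meson dvd_trans le_SucI le_imp_power_dvd)
  have "?d (euler_fps 1 * ?P) (qpoch (?X ^ 1) (5 * N) * ?P)"
    by (intro dvd_diff_mult trunc) auto
  also have "qpoch (?X ^ 1) (5 * N) * ?P = qpoch (?X ^ 5) N * (?A * ?B * ?P)"
    unfolding power_one_right qpoch_mult_5 by (simp only: mult_ac)
  finally have 1: "?d (euler_fps 1 * ?P) (qpoch (?X ^ 5) N * (?A * ?B * ?P))" .
  have "?X ^ N dvd - (?P * (?A * ?B * ?P) - qpoch (?X ^ 5) N * (?A * ?B * ?P))"
    unfolding dvd_minus_iff by (intro dvd_diff_mult trunc) auto
  then have 2: "?d (qpoch (?X ^ 5) N * (?A * ?B * ?P)) (?P * (?A * ?B * ?P))"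
    by (simp only: minus_diff_eq)
  have "?d (?A * ?P * (?B * ?P)) (theta_fps 5 1 parity_sign * theta_fps 5 2 parity_sign)"
    using theta_fps_triple_trunc[of 1 5 N] theta_fps_triple_trunc[of 2 5 N] by (intro dvd_diff_mult) simp_all
  also have "?A * ?P * (?B * ?P) = ?P * (?A * ?B * ?P)"
    by (simp only: mult_ac)
  finally show "?d (euler_fps 1 * ?P) (theta_fps 5 1 parity_sign * theta_fps 5 2 parity_sign)"
    using 1 2 dvd_diff_trans by blast
qed

text \<open>The factor 2 arises because j and -1 - j contribute equal terms to the sum over all
  integers.\<close>

lemma euler_1_cube:
  "2 * euler_fps 1 ^ 3 = theta_fps 1 0 (\<lambda>j. parity_sign j * (2 * j + 1))"
proof (rule fps_eq_by_truncation)
  fix N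
  let ?P = "euler_fps 1" and ?q = "qpoch fps_X N :: int fps"
  have "fps_X ^ N dvd ?P - ?q"
    using euler_trunc[of 1 N] by (simp add: dvd_mult_right)
  then have "fps_X ^ N dvd 2 * (?P * ?P) * ?P - 2 * (?q * ?q) * ?P"
    by (intro dvd_diff_mult) auto
  moreover have "fps_X ^ N dvd 2 * ?q\<^sup>2 * ?P - theta_fps 1 0 (\<lambda>j. parity_sign j * (2 * j + 1))"
    unfolding finite_jacobi by (rule qbinom_sum_trunc) auto
  ultimately show "fps_X ^ N dvd 2 * ?P ^ 3 - theta_fps 1 0 (\<lambda>j. parity_sign j * (2 * j + 1))"
    unfolding power2_eq_square power3_eq_cube mult.assoc by (rule dvd_diff_trans)
qed

lemma theta_fps_mult_nth:
  assumes "c > 0" and "a \<le> c" and "c' > 0" and "a' \<le> c'"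
  shows "fps_nth (theta_fps c a w * theta_fps c' a' w') n =
    (\<Sum>(j, k) | theta_exp c a j + theta_exp c' a' k = n. w j * w' k)"
proof -
  define A where "A i = {j. theta_exp c a j = i}" for i
  define B where "B i = {k. theta_exp c' a' k = i}" for i
  have fin: "finite (A i)" "finite (B i)" for i
    using assms finite_theta_exp_fibre by (simp_all add: A_def B_def)
  have "fps_nth (theta_fps c a w * theta_fps c' a' w') n = (\<Sum>i\<in>{0..n}. \<Sum>(j, k)\<in>A i \<times> B (n - i). w j * w' k)"
    by (simp add: fps_mult_nth theta_fps_def A_def B_def sum_product sum.cartesian_product)
  also have "\<dots> = (\<Sum>(j, k)\<in>(\<Union>i\<in>{0..n}. A i \<times> B (n - i)). w j * w' k)"
    by (rule sum.UNION_disjoint[symmetric]) (auto simp: fin, auto simp: A_def)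
  also have "(\<Union>i\<in>{0..n}. A i \<times> B (n - i)) = {(j, k). theta_exp c a j + theta_exp c' a' k = n}"
    by (auto simp: A_def B_def)
  finally show ?thesis .
qed

lemma parity_sign_diff: "parity_sign (j - k) = parity_sign j * parity_sign k"
  by (auto simp: parity_sign_def)

text \<open>Put u + v = 2 j + 1 and u - v = 2 k + 1: the product of the two weights becomes u^2 -
  v^2. All pairs are reached, since an odd norm makes u + v odd.\<close>

lemma euler_1_power_6_nth: "4 * fps_nth (euler_fps 1 ^ 6) n = theta3 (4 * n + 1)"
proof -
  let ?w = "\<lambda>j. parity_sign j * (2 * j + 1)"
  have "4 * euler_fps 1 ^ 6 = (2 * euler_fps 1 ^ 3) * (2 * euler_fps 1 ^ 3)"
    by (simp add: mult_ac flip: power_add)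
  then have "fps_nth (4 * euler_fps 1 ^ 6) n = (\<Sum>(j, k) | theta_exp 1 0 j + theta_exp 1 0 k = n. ?w j * ?w k)"
    unfolding euler_1_cube by (simp add: theta_fps_mult_nth)
  also have "\<dots> = theta3 (4 * n + 1)"
    unfolding theta3_def
  proof (rule sum.reindex_bij_witness[of _ "\<lambda>(u, v). ((u + v - 1) div 2, (u - v - 1) div 2)"
      "\<lambda>(j, k). (j + k + 1, j - k)"], goal_cases)
    case (1 z)
    then show ?case
      by (auto simp: case_prod_unfold)
  next
    case (2 z)
    obtain j k where z: "z = (j, k)" by force
    have "int (theta_exp 1 0 j) + int (theta_exp 1 0 k) = int n"
      using 2 z by auto
    then have "j * (j + 1) div 2 + k * (k + 1) div 2 = int n"
      by (simp add: int_theta_exp)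
    moreover have "(j + k + 1)\<^sup>2 + (j - k)\<^sup>2 = 2 * (j * (j + 1)) + 2 * (k * (k + 1)) + 1"
      by (simp add: power2_eq_square algebra_simps)
    ultimately have "(j + k + 1)\<^sup>2 + (j - k)\<^sup>2 = 4 * int n + 1"
      using triangular_double[of j] triangular_double[of k] by linarith
    then show ?case
      by (simp add: z norm_reps_def)
  next
    case (3 z)
    then obtain u v where z: "z = (u, v)" and uv: "u\<^sup>2 + v\<^sup>2 = 4 * int n + 1"
      by (auto simp: norm_reps_def)
    have "odd (u\<^sup>2 + v\<^sup>2)"
      unfolding uv by simp
    then have "odd (u + v)"
      by simp
    then obtain j where j: "u + v = 2 * j + 1"
      by (elim oddE)
    define k where "k = j - v"
    have "u + v - 1 = 2 * j" "u - v - 1 = 2 * k"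
      using j by (simp_all add: k_def)
    note jk = this
    show ?case
      unfolding z prod.case jk using j by (simp add: k_def)
  next
    case (4 z)
    then obtain u v where z: "z = (u, v)" and uv: "u\<^sup>2 + v\<^sup>2 = 4 * int n + 1"
      by (auto simp: norm_reps_def)
    have "odd (u\<^sup>2 + v\<^sup>2)"
      unfolding uv by simp
    then have "odd (u + v)"
      by simp
    then obtain j where j: "u + v = 2 * j + 1"
      by (elim oddE)
    define k where "k = j - v"
    have k: "u - v = 2 * k + 1"
      using j by (simp add: k_def)
    have "4 * (j * (j + 1) div 2 + k * (k + 1) div 2) = 4 * int n"
      using triangular_double[of j] triangular_double[of k] uv j k by algebra
    then have "int (theta_exp 1 0 j + theta_exp 1 0 k) = int n"
      by (simp add: int_theta_exp)
    then have "theta_exp 1 0 j + theta_exp 1 0 k = n"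
      by (simp only: of_nat_eq_iff)
    with j k show ?case
      by (simp add: z)
  next
    case (5 z)
    obtain j k where z: "z = (j, k)" by force
    show ?case
      by (simp add: z parity_sign_diff algebra_simps power2_eq_square)
  qed
  finally show ?thesis
    by (simp add: numeral_fps_const)
qed

text \<open>
  The substitution comes from \<open>40 n + 10 = (10 j + 3)\<^sup>2 + (10 k + 1)\<^sup>2\<close> by dividing
  \<open>(10 j + 3) + i (10 k + 1)\<close> by \<open>3 + i\<close>. It reaches only the class 1 of \<open>u - 2 v\<close> modulo 5; multiplication
  by \<open>i\<close> permutes the four nonzero classes cyclically.
\<close>
lemma euler_1_mult_euler_5_nth: "4 * fps_nth (euler_fps 1 * euler_fps 5) n = theta1 (4 * n + 1)"
proof -
  let ?L = "norm_reps (4 * n + 1)"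
  let ?g = "\<lambda>(u, v). parity_sign v * chi5 (u - 2 * v)"
  define L where "L r = {(u, v)\<in>?L. (u - 2 * v) mod 5 = r}" for r
  have fin: "finite (L r)" for r
    unfolding L_def by (rule finite_subset[OF _ finite_norm_reps]) auto
  have odd: "odd (u + v)" if "(u, v) \<in> ?L" for u v
  proof -
    have "u\<^sup>2 + v\<^sup>2 = 4 * int n + 1"
      using that by (simp add: norm_reps_def)
    then have "odd (u\<^sup>2 + v\<^sup>2)"
      by simp
    then show ?thesis
      by simp
  qed
  \<comment> \<open>Multiplication by i triples u - 2 v modulo 5, which flips its character; as u +
    v is odd, the parity sign flips too.\<close>
  have rot: "sum ?g (L r) = sum ?g (L r')" if "(3 * r) mod 5 = r'" "(2 * r') mod 5 = r" for r r'
  proof (rule sum.reindex_bij_witness[of _ "\<lambda>(u, v). (v, - u)" "\<lambda>(u, v). (- v, u)"], goal_cases)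
    case (2 z)
    then obtain u v where z: "z = (u, v)" "(u, v) \<in> ?L" "(u - 2 * v) mod 5 = r"
      by (auto simp: L_def)
    have "[- v - 2 * u = 3 * (u - 2 * v)] (mod 5)"
      by (simp add: cong_iff_dvd_diff algebra_simps)
    then have "(- v - 2 * u) mod 5 = r'"
      using that z by (metis cong_def mod_mult_right_eq)
    then show ?case
      using z by (simp add: L_def norm_reps_def add.commute)
  next
    case (4 z)
    then obtain u v where z: "z = (u, v)" "(u, v) \<in> ?L" "(u - 2 * v) mod 5 = r'"
      by (auto simp: L_def)
    have "[v - 2 * (- u) = 2 * (u - 2 * v)] (mod 5)"
      by (simp add: cong_iff_dvd_diff algebra_simps)
    then have "(v - 2 * (- u)) mod 5 = r"
      using that z by (metis cong_def mod_mult_right_eq)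
    then show ?case
      using z by (simp add: L_def norm_reps_def add.commute)
  next
    case (5 z)
    then obtain u v where z: "z = (u, v)" "(u, v) \<in> ?L"
      by (auto simp: L_def)
    have "[- v - 2 * u = - (2 * (u - 2 * v))] (mod 5)"
      by (simp add: cong_iff_dvd_diff algebra_simps)
    then have "chi5 (- v - 2 * u) = - chi5 (u - 2 * v)"
      using chi5_cong chi5_uminus chi5_double by metis
    moreover have "parity_sign u = - parity_sign v"
      using odd[OF z(2)] by (auto simp: parity_sign_def)
    ultimately show ?case
      by (simp add: z)
  qed auto
  have "theta1 (4 * n + 1) = sum ?g (L 1 \<union> L 2 \<union> L 3 \<union> L 4)"
    unfolding theta1_def
  proof (intro sum.mono_neutral_right finite_norm_reps ballI)
    fix z assume z: "z \<in> ?L - (L 1 \<union> L 2 \<union> L 3 \<union> L 4)"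
    obtain u v where uv: "z = (u, v)" by force
    have "(u - 2 * v) mod 5 = 0"
      using z mod5_cases[of "u - 2 * v"] unfolding L_def uv by blast
    then show "?g z = 0"
      by (simp add: uv chi5_def)
  qed (auto simp: L_def)
  also have "\<dots> = sum ?g (L 1) + sum ?g (L 2) + sum ?g (L 3) + sum ?g (L 4)"
    by (subst sum.union_disjoint; (auto simp: fin)?; (auto simp: L_def; fail)?)+
  also have "\<dots> = 4 * sum ?g (L 1)"
    using rot[of 1 3] rot[of 3 4] rot[of 4 2] by simp
  also have "sum ?g (L 1) = (\<Sum>(j, k) | theta_exp 5 1 j + theta_exp 5 2 k = n. parity_sign j * parity_sign k)"
  proof (rule sum.reindex_bij_witness[symmetric, of _ "\<lambda>(u, v). (3 * ((u + 3 * v - 1) div 10) - v, (u + 3 * v - 1) div 10)"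
      "\<lambda>(j, k). (3 * j + k + 1, 3 * k - j)"], goal_cases)
    case (1 z)
    obtain j k where z: "z = (j, k)" by force
    have "3 * j + k + 1 + 3 * (3 * k - j) - 1 = 10 * k"
      by simp
    then show ?case
      unfolding z prod.case by simp
  next
    case (2 z)
    obtain j k where z: "z = (j, k)" by force
    have "int (theta_exp 5 1 j) + int (theta_exp 5 2 k) = int n"
      using 2 z by auto
    then have "5 * (j * (j + 1) div 2) - j + (5 * (k * (k + 1) div 2) - 2 * k) = int n"
      by (simp add: int_theta_exp)
    moreover have "(3 * j + k + 1)\<^sup>2 + (3 * k - j)\<^sup>2 = 10 * (j * (j + 1)) - 4 * j + 10 * (k * (k + 1)) - 8 * k + 1"
      by (simp add: power2_eq_square algebra_simps)
    ultimately have "(3 * j + k + 1)\<^sup>2 + (3 * k - j)\<^sup>2 = 4 * int n + 1"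
      using triangular_double[of j] triangular_double[of k] by linarith
    moreover have "(3 * j + k + 1 - 2 * (3 * k - j)) mod 5 = 1"
      by presburger
    ultimately show ?case
      by (simp add: z norm_reps_def L_def)
  next
    case (3 z)
    then obtain u v where z: "z = (u, v)" "(u, v) \<in> ?L" "(u - 2 * v) mod 5 = 1"
      by (auto simp: L_def)
    \<comment> \<open>Modulo 2 this is the oddness of u + v; modulo 5, u + 3 v is u - 2 v.\<close>
    have "10 dvd u + 3 * v - 1"
      using odd[OF z(2)] z(3) by presburger
    then obtain k where "u + 3 * v - 1 = 10 * k" ..
    moreover from this have "u = 10 * k + 1 - 3 * v" by simp
    ultimately show ?case
      by (simp add: z)
  next
    case (4 z)
    then obtain u v where z: "z = (u, v)" "(u, v) \<in> ?L" "(u - 2 * v) mod 5 = 1"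
      by (auto simp: L_def)
    have "10 dvd u + 3 * v - 1"
      using odd[OF z(2)] z(3) by presburger
    then obtain k where k: "u + 3 * v - 1 = 10 * k" ..
    define j where "j = 3 * k - v"
    have "u\<^sup>2 + v\<^sup>2 = 4 * int n + 1"
      using z by (simp add: norm_reps_def)
    then have "4 * (5 * (j * (j + 1) div 2) - j + (5 * (k * (k + 1) div 2) - 2 * k)) = 4 * int n"
      using triangular_double[of j] triangular_double[of k] k j_def by algebra
    then have "int (theta_exp 5 1 j + theta_exp 5 2 k) = int n"
      by (simp add: int_theta_exp)
    then have "theta_exp 5 1 j + theta_exp 5 2 k = n"
      by (simp only: of_nat_eq_iff)
    with k show ?case
      by (simp add: z j_def)
  next
    case (5 z)
    obtain j k where z: "z = (j, k)" by force
    have "(3 * j + k + 1 - 2 * (3 * k - j)) mod 5 = 1"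
      by presburger
    then show ?case
      by (simp add: z chi5_def) (simp add: parity_sign_def)
  qed
  finally show ?thesis
    by (simp only: euler_1_mult_euler_5) (simp add: theta_fps_mult_nth)
qed

text \<open>The witness for strictness is n = 3: 4 n + 1 = 13 is a nonresidue modulo 5, so
  \<open>theta1 13\<close> vanishes, while 40 is not divisible by 25.\<close>

lemma theta3_13: "theta3 13 = 40"
proof -
  have "norm_reps 13 = {(2, 3), (2, - 3), (- 2, 3), (- 2, - 3), (3, 2), (3, - 2), (- 3, 2), (- 3, - 2)}"
  proof -
    have le: "\<bar>u\<bar> \<le> 3" if "u\<^sup>2 + v\<^sup>2 = 13" for u v :: int
    proof (rule ccontr)
      assume "\<not> \<bar>u\<bar> \<le> 3"
      then have "4\<^sup>2 \<le> \<bar>u\<bar>\<^sup>2"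
        by (intro power_mono) auto
      then show False
        using that zero_le_power2[of v] by simp
    qed
    have "(u, v) \<in> {(2, 3), (2, - 3), (- 2, 3), (- 2, - 3), (3, 2), (3, - 2), (- 3, 2), (- 3, - 2)}"
      if "u\<^sup>2 + v\<^sup>2 = 13" for u v :: int
    proof -
      have "u \<in> {- 3, - 2, - 1, 0, 1, 2, 3}" "v \<in> {- 3, - 2, - 1, 0, 1, 2, 3}"
        using le[of u v] le[of v u] that by auto
      then show ?thesis
        using that by (elim insertE emptyE; hypsubst) simp_all
    qed
    then show ?thesis
      by (auto simp: norm_reps_def)
  qed
  then show ?thesis
    by (simp add: theta3_def parity_sign_def)
qed

theorem theorem4p14:
  fixes a b :: "nat \<Rightarrow> int"
  assumes "euler_fps 1 * euler_fps 5 = Abs_fps a"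
    and "euler_fps 1 ^ 6 = Abs_fps b"
  shows "{n. [b n = 0] (mod 25)} \<subset> {n. [a n = 0] (mod 25)}"
proof -
  have a: "4 * a n = theta1 (4 * n + 1)" for n
    using euler_1_mult_euler_5_nth[of n] unfolding assms(1) by simp
  have b: "4 * b n = theta3 (4 * n + 1)" for n
    using euler_1_power_6_nth[of n] unfolding assms(2) by simp
  have "25 dvd a n" if "25 dvd b n" for n
  proof -
    have "25 dvd theta3 (4 * n + 1)"
      using that unfolding b[symmetric] by simp
    then have "25 dvd 4 * a n"
      unfolding a by (intro dvd_theta1) auto
    then show ?thesis
      by presburger
  qed
  moreover have "b 3 = 10"
    using b[of 3] theta3_13 by simp
  moreover have "a 3 = 0"
    using a[of 3] theta1_eq_0[of 13] by (simp add: chi5_def)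
  ultimately show ?thesis
    by (auto simp: cong_0_iff psubset_eq set_eq_iff intro!: exI[of _ 3])
qed

end
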